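(* Let $L\ge 2$ and fix layer widths $d_0,\dots,d_L$, integers $K_{\ell,j}\ge1$, degrees $r^{(\ell)}_{j,k}\ge 1$, exponents $\alpha_\ell>0$, parameters $w^{(\ell)}_{j,k}\in\mathbb{R}^{d_{\ell-1}}$, $b^{(\ell)}_{j,k}\in\mathbb{R}$, a constant $\mu\ge0$, and permutations $\Pi_\ell$ of $\{1,\dots,d_\ell\}$ for $\ell=2,\dots,L-1$. Then the total Frobenius regularizer $\mathcal{R}^{\mathrm{tot}}_{\mathrm F}(\{D_\ell\})$ defined in the context is a posynomial in the positive variables $\{d_{\ell,i}: 1\le\ell\le L-1,\ 1\le i\le d_\ell\}$. Hence the problem $$\min_{\{d_{\ell,i}>0\}}\ \mathcal{R}^{\mathrm{tot}}_{\mathrm F}(\{D_\ell\}),$$ optionally subject to $\prod_{i=1}^{d_\ell}d_{\ell,i}=1$ for $\ell=1,\dots,L-1$ and optionally subject to $d_{\min}\le d_{\ell,i}\le d_{\max}$ for all $\ell,i$ (with constants $0<d_{\min}\le d_{\max}$), is a geometric program, and after the change of variables $t_{\ell,i}=\log d_{\ell,i}$ it becomes a convex optimization problem: the objective is a convex function of $(t_{\ell,i})$ and the feasible set is convex.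
   Context: For $\ell=1,\dots,L-1$, $D_\ell=\mathrm{diag}(d_{\ell,1},\dots,d_{\ell,d_\ell})$ with $d_{\ell,i}>0$. Indices run over $j=1,\dots,d_\ell$ and $k=1,\dots,K_{\ell,j}$. For $\ell=1,\dots,L-1$ put $\gamma^{(\ell)}_{j,k}:=\frac{2}{\alpha_\ell r^{(\ell)}_{j,k}}$. The $p$-th entry of a vector $w$ is written $w[p]$. The total Frobenius regularizer is $$\mathcal{R}^{\mathrm{tot}}_{\mathrm F}(\{D_\ell\})=\mathcal{R}^{(1)}_{\mathrm F}(D_1)+\sum_{\ell=2}^{L-1}\mathcal{R}^{(\ell)}_{\mathrm F}(D_{\ell-1},\Pi_\ell,D_\ell)+\mathcal{R}^{(L)}_{\mathrm F}(D_{L-1}),$$ where $$\mathcal{R}^{(1)}_{\mathrm F}(D_1)=\sum_{j=1}^{d_1}\sum_{k=1}^{K_{1,j}}\Big(\|w^{(1)}_{j,k}\|_2^2+\mu(b^{(1)}_{j,k})^2\Big)d_{1,j}^{\gamma^{(1)}_{j,k}},$$ and for $\ell=2,\dots,L-1$, writing $j=\Pi_\ell(i)$, $$\mathcal{R}^{(\ell)}_{\mathrm F}(D_{\ell-1},\Pi_\ell,D_\ell)=\sum_{i=1}^{d_\ell}\sum_{k=1}^{K_{\ell,j}}\Big(\sum_{p=1}^{d_{\ell-1}}(w^{(\ell)}_{j,k}[p])^2d_{\ell-1,p}^{-2}+\mu(b^{(\ell)}_{j,k})^2\Big)d_{\ell,i}^{\gamma^{(\ell)}_{j,k}},$$ and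 $$\mathcal{R}^{(L)}_{\mathrm F}(D_{L-1})=\sum_{i=1}^{d_{L-1}}C^{(L-1)}_i d_{L-1,i}^{-2}+\mu\sum_{j=1}^{d_L}\sum_{k=1}^{K_{L,j}}(b^{(L)}_{j,k})^2,\qquad C^{(L-1)}_i=\sum_{j=1}^{d_L}\sum_{k=1}^{K_{L,j}}(w^{(L)}_{j,k}[i])^2.$$ A monomial in positive variables $x_1,\dots,x_n$ is a function $c\,x_1^{a_1}\cdots x_n^{a_n}$ with $c>0$ and $a_i\in\mathbb{R}$; a posynomial is a finite sum of monomials (terms with zero coefficient are dropped; the empty sum, i.e. the zero function, is allowed). A geometric program is the minimization of a posynomial over positive variables subject to constraints of the form (posynomial) $\le$ (monomial) and (monomial) $=$ (monomial). *)

theory Defs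
  imports "HOL-Analysis.Analysis" "HOL-Analysis.Finite_Function_Topology"
begin

section \<open>Geometric programs\<close>

definition pos_orthant :: "'v set \<Rightarrow> ('v \<Rightarrow> real) set" where
  "pos_orthant V = V \<rightarrow>\<^sub>E {0<..}"

definition monomial_fun :: "'v set \<Rightarrow> (('v \<Rightarrow> real) \<Rightarrow> real) \<Rightarrow> bool" where
  "monomial_fun V f \<longleftrightarrow>
     (\<exists>c>0. \<exists>a. \<forall>x\<in>pos_orthant V. f x = c * (\<Prod>v\<in>V. x v powr a v))"

definition posynomial_fun :: "'v set \<Rightarrow> (('v \<Rightarrow> real) \<Rightarrow> real) \<Rightarrow> bool" where
  "posynomial_fun V f \<longleftrightarrow>
     (\<exists>ms. (\<forall>m\<in>set ms. monomial_fun V m) \<and> (\<forall>x\<in>pos_orthant V. f x = (\<Sum>m\<leftarrow>ms. m x)))"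

datatype 'v cstr =
    Le "('v \<Rightarrow> real) \<Rightarrow> real" "('v \<Rightarrow> real) \<Rightarrow> real"
  | Eq "('v \<Rightarrow> real) \<Rightarrow> real" "('v \<Rightarrow> real) \<Rightarrow> real"

fun satisfies :: "('v \<Rightarrow> real) \<Rightarrow> 'v cstr \<Rightarrow> bool" where
  "satisfies x (Le f g) \<longleftrightarrow> f x \<le> g x"
| "satisfies x (Eq f g) \<longleftrightarrow> f x = g x"

fun gp_cstr :: "'v set \<Rightarrow> 'v cstr \<Rightarrow> bool" where
  "gp_cstr V (Le f g) \<longleftrightarrow> posynomial_fun V f \<and> monomial_fun V g"
| "gp_cstr V (Eq f g) \<longleftrightarrow> monomial_fun V f \<and> monomial_fun V g"

text \<open>Minimization of \<open>objective\<close> over positive variables indexed by \<open>vars\<close>, subject to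
  \<open>cstrs\<close>.\<close>

record 'v program =
  vars :: "'v set"
  objective :: "('v \<Rightarrow> real) \<Rightarrow> real"
  cstrs :: "'v cstr set"

definition feasible :: "'v program \<Rightarrow> ('v \<Rightarrow> real) set" where
  "feasible P = {x \<in> pos_orthant (vars P). \<forall>c\<in>cstrs P. satisfies x c}"

definition geometric_program :: "'v program \<Rightarrow> bool" where
  "geometric_program P \<longleftrightarrow>
     finite (vars P) \<and> finite (cstrs P) \<and>
     posynomial_fun (vars P) (objective P) \<and> (\<forall>c\<in>cstrs P. gp_cstr (vars P) c)"

text \<open>The logarithmic variables range over the real vector space of \<open>V\<close>-indexed tuples, represented
  by finitely supported functions with support in the (finite) set \<open>V\<close>. The substitution
  \<open>t v = ln (x v)\<close> is expressed through its inverse \<open>x v = exp (t v)\<close>; the lemmas below confirm that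
  this is a bijection onto the positive orthant.\<close>

definition log_space :: "'v set \<Rightarrow> ('v \<Rightarrow>\<^sub>0 real) set" where
  "log_space V = {t. Poly_Mapping.keys t \<subseteq> V}"

definition exp_point :: "'v set \<Rightarrow> ('v \<Rightarrow>\<^sub>0 real) \<Rightarrow> 'v \<Rightarrow> real" where
  "exp_point V t = (\<lambda>v\<in>V. exp (Poly_Mapping.lookup t v))"

definition log_objective :: "'v program \<Rightarrow> ('v \<Rightarrow>\<^sub>0 real) \<Rightarrow> real" where
  "log_objective P t = objective P (exp_point (vars P) t)"

definition log_feasible :: "'v program \<Rightarrow> ('v \<Rightarrow>\<^sub>0 real) set" where
  "log_feasible P = {t \<in> log_space (vars P). exp_point (vars P) t \<in> feasible P}"

lemma ln_exp_point: "v \<in> V \<Longrightarrow> ln (exp_point V t v) = Poly_Mapping.lookup t v"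
  by (simp add: exp_point_def)

lemma bij_betw_exp_point:
  assumes "finite V"
  shows "bij_betw (exp_point V) (log_space V) (pos_orthant V)"
proof (rule bij_betw_imageI)
  show "inj_on (exp_point V) (log_space V)"
  proof (rule inj_onI)
    fix s t assume st: "s \<in> log_space V" "t \<in> log_space V" "exp_point V s = exp_point V t"
    show "s = t"
    proof (rule poly_mapping_eqI)
      fix v
      show "Poly_Mapping.lookup s v = Poly_Mapping.lookup t v"
      proof (cases "v \<in> V")
        case True
        then show ?thesis using st(3) ln_exp_point by metis
      next
        case False
        then have "v \<notin> Poly_Mapping.keys s" "v \<notin> Poly_Mapping.keys t"
          using st(1,2) by (auto simp: log_space_def)
        then show ?thesis by (simp add: in_keys_iff)
      qed
    qed
  qed
  show "exp_point V ` log_space V = pos_orthant V"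
  proof
    show "exp_point V ` log_space V \<subseteq> pos_orthant V"
      by (auto simp: exp_point_def pos_orthant_def)
    show "pos_orthant V \<subseteq> exp_point V ` log_space V"
    proof
      fix x assume x: "x \<in> pos_orthant V"
      define g where "g v = (if v \<in> V then ln (x v) else 0)" for v
      have "finite {v. g v \<noteq> 0}"
        by (rule finite_subset[OF _ assms]) (auto simp: g_def)
      then have l: "Poly_Mapping.lookup (Abs_poly_mapping g) = g"
        by simp
      have "Abs_poly_mapping g \<in> log_space V"
        by (auto simp: log_space_def in_keys_iff l g_def split: if_splits)
      moreover have "exp_point V (Abs_poly_mapping g) = x"
        using x by (auto simp: exp_point_def l g_def pos_orthant_def PiE_iff extensional_def)
      ultimately show "x \<in> exp_point V ` log_space V" by force
    qed
  qed
qed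

section \<open>The Frobenius regularizer\<close>

text \<open>All indices start at 1. Vectors and diagonal matrices are given by their entries:
  \<open>weight N l j k p\<close> is the \<open>p\<close>-th entry of the weight vector, and \<open>D l i\<close> is the \<open>i\<close>-th diagonal
  entry of the \<open>l\<close>-th diagonal matrix. Values outside the index ranges are irrelevant.\<close>

record net =
  depth :: nat
  width :: "nat \<Rightarrow> nat"
  mult :: "nat \<Rightarrow> nat \<Rightarrow> nat"
  deg :: "nat \<Rightarrow> nat \<Rightarrow> nat \<Rightarrow> real"
  expo :: "nat \<Rightarrow> real"
  weight :: "nat \<Rightarrow> nat \<Rightarrow> nat \<Rightarrow> nat \<Rightarrow> real"
  bias :: "nat \<Rightarrow> nat \<Rightarrow> nat \<Rightarrow> real"
  mu :: real
  perm :: "nat \<Rightarrow> nat \<Rightarrow> nat"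

definition gamma :: "net \<Rightarrow> nat \<Rightarrow> nat \<Rightarrow> nat \<Rightarrow> real" where
  "gamma N l j k = 2 / (expo N l * deg N l j k)"

definition reg_first :: "net \<Rightarrow> (nat \<Rightarrow> real) \<Rightarrow> real" where
  "reg_first N D1 =
     (\<Sum>j=1..width N 1. \<Sum>k=1..mult N 1 j.
        ((L2_set (weight N 1 j k) {1..width N 0})\<^sup>2 + mu N * (bias N 1 j k)\<^sup>2)
          * D1 j powr gamma N 1 j k)"

definition reg_mid :: "net \<Rightarrow> nat \<Rightarrow> (nat \<Rightarrow> real) \<Rightarrow> (nat \<Rightarrow> nat) \<Rightarrow> (nat \<Rightarrow> real) \<Rightarrow> real" where
  "reg_mid N l Dprev \<pi> D =
     (\<Sum>i=1..width N l. let j = \<pi> i in \<Sum>k=1..mult N l j.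
        ((\<Sum>p=1..width N (l - 1). (weight N l j k p)\<^sup>2 * Dprev p powr (-2))
            + mu N * (bias N l j k)\<^sup>2)
          * D i powr gamma N l j k)"

definition last_coeff :: "net \<Rightarrow> nat \<Rightarrow> real" where
  "last_coeff N i =
     (\<Sum>j=1..width N (depth N). \<Sum>k=1..mult N (depth N) j. (weight N (depth N) j k i)\<^sup>2)"

definition reg_last :: "net \<Rightarrow> (nat \<Rightarrow> real) \<Rightarrow> real" where
  "reg_last N Dprev =
     (\<Sum>i=1..width N (depth N - 1). last_coeff N i * Dprev i powr (-2))
     + mu N * (\<Sum>j=1..width N (depth N). \<Sum>k=1..mult N (depth N) j. (bias N (depth N) j k)\<^sup>2)"

definition reg_total :: "net \<Rightarrow> (nat \<Rightarrow> nat \<Rightarrow> real) \<Rightarrow> real" where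
  "reg_total N D =
     reg_first N (D 1)
     + (\<Sum>l=2..depth N - 1. reg_mid N l (D (l - 1)) (perm N l) (D l))
     + reg_last N (D (depth N - 1))"

definition scale_vars :: "net \<Rightarrow> (nat \<times> nat) set" where
  "scale_vars N = (SIGMA l:{1..depth N - 1}. {1..width N l})"

definition reg_objective :: "net \<Rightarrow> (nat \<times> nat \<Rightarrow> real) \<Rightarrow> real" where
  "reg_objective N x = reg_total N (\<lambda>l i. x (l, i))"

definition unit_product_cstrs :: "net \<Rightarrow> (nat \<times> nat) cstr set" where
  "unit_product_cstrs N =
     (\<lambda>l. Eq (\<lambda>x. \<Prod>i=1..width N l. x (l, i)) (\<lambda>x. 1)) ` {1..depth N - 1}"

definition box_cstrs :: "net \<Rightarrow> real \<Rightarrow> real \<Rightarrow> (nat \<times> nat) cstr set" where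
  "box_cstrs N dmin dmax =
     (\<lambda>v. Le (\<lambda>x. dmin) (\<lambda>x. x v)) ` scale_vars N
     \<union> (\<lambda>v. Le (\<lambda>x. x v) (\<lambda>x. dmax)) ` scale_vars N"

text \<open>The two flags switch the optional constraint families on and off.\<close>

definition reg_program :: "net \<Rightarrow> bool \<Rightarrow> bool \<Rightarrow> real \<Rightarrow> real \<Rightarrow> (nat \<times> nat) program" where
  "reg_program N normalized boxed dmin dmax =
     \<lparr>vars = scale_vars N,
      objective = reg_objective N,
      cstrs = (if normalized then unit_product_cstrs N else {})
        \<union> (if boxed then box_cstrs N dmin dmax else {})\<rparr>"

end

theory Submission
  imports Defs
begin

text \<open>In logarithmic variables \<open>x v = exp (t v)\<close> a monomial \<open>c * (\<Prod>v. x v powr a v)\<close> becomes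
  \<open>c\<close> times the exponential of the linear form \<open>\<Sum>v. a v * t v\<close>, hence is convex; a posynomial is a
  finite sum of such functions, hence convex as well (\<open>convex_on_posynomial\<close>). A constraint
  \<open>f \<le> g\<close> between a posynomial and a monomial is equivalent to \<open>f / g \<le> 1\<close>. Since posynomials are
  closed under multiplication by monomials and monomials under inversion, \<open>f / g\<close> is again a posynomial, so the
  constraint cuts out a convex sublevel set (\<open>convex_log_le\<close>). A monomial equation is a
  pair of opposite inequalities of this kind. Therefore every geometric program is convex in
  logarithmic variables.

  For the regularizer, the closure of posynomials under sums and under multiplication by monomials
  applies to the defining formula, all of whose coefficients are sums of squares or multiples of
  squares by \<open>\<mu> \<ge> 0\<close>. The normalization equates a product of variables, which is a monomial, with
  the monomial \<open>1\<close>; the box constraints compare a single variable with a positive constant.\<close>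

lemma pos_orthant_pos: "x \<in> pos_orthant V \<Longrightarrow> v \<in> V \<Longrightarrow> x v > 0"
  by (auto simp: pos_orthant_def PiE_iff)

lemma exp_point_in_pos_orthant: "exp_point V t \<in> pos_orthant V"
  by (auto simp: exp_point_def pos_orthant_def)

lemma monomial_fun_cong:
  assumes "monomial_fun V f" "\<And>x. x \<in> pos_orthant V \<Longrightarrow> g x = f x"
  shows "monomial_fun V g"
  using assms by (auto simp: monomial_fun_def)

lemma monomial_fun_pos:
  assumes "monomial_fun V f" "x \<in> pos_orthant V"
  shows "f x > 0"
proof -
  obtain c a where "c > 0" "f x = c * (\<Prod>v\<in>V. x v powr a v)"
    using assms by (auto simp: monomial_fun_def)
  moreover have "(\<Prod>v\<in>V. x v powr a v) > 0"
    by (rule prod_pos) (auto dest: pos_orthant_pos[OF assms(2)])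
  ultimately show ?thesis by simp
qed

lemma monomial_fun_const:
  assumes "c > 0"
  shows "monomial_fun V (\<lambda>x. c)"
proof -
  have "(\<Prod>v\<in>V. x v powr 0) = 1" if "x \<in> pos_orthant V" for x
    by (rule prod.neutral) (auto dest: pos_orthant_pos[OF that])
  then show ?thesis
    unfolding monomial_fun_def using assms
    by (intro exI[of _ c] conjI exI[of _ "\<lambda>_. 0"]) auto
qed

lemma monomial_fun_powr:
  assumes "finite V" "w \<in> V"
  shows "monomial_fun V (\<lambda>x. x w powr e)"
proof -
  have "(\<Prod>v\<in>V. x v powr (if v = w then e else 0)) = x w powr e" if x: "x \<in> pos_orthant V" for x
  proof -
    have "(\<Prod>v\<in>V. x v powr (if v = w then e else 0)) = (\<Prod>v\<in>V. if v = w then x v powr e else 1)"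
      by (rule prod.cong) (auto dest: pos_orthant_pos[OF x])
    also have "\<dots> = x w powr e"
      using assms by simp
    finally show ?thesis .
  qed
  then show ?thesis
    unfolding monomial_fun_def
    by (intro exI[of _ 1] conjI exI[of _ "\<lambda>v. if v = w then e else 0"]) auto
qed

lemma monomial_fun_var:
  assumes "finite V" "w \<in> V"
  shows "monomial_fun V (\<lambda>x. x w)"
  by (rule monomial_fun_cong[OF monomial_fun_powr[OF assms, of 1]])
     (simp add: less_imp_le pos_orthant_pos[OF _ assms(2)])

lemma monomial_fun_mult:
  assumes "monomial_fun V f" "monomial_fun V g"
  shows "monomial_fun V (\<lambda>x. f x * g x)"
proof -
  obtain c a where f: "c > 0" "\<And>x. x \<in> pos_orthant V \<Longrightarrow> f x = c * (\<Prod>v\<in>V. x v powr a v)"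
    using assms(1) by (auto simp: monomial_fun_def)
  obtain d b where g: "d > 0" "\<And>x. x \<in> pos_orthant V \<Longrightarrow> g x = d * (\<Prod>v\<in>V. x v powr b v)"
    using assms(2) by (auto simp: monomial_fun_def)
  have "f x * g x = (c * d) * (\<Prod>v\<in>V. x v powr (a v + b v))" if "x \<in> pos_orthant V" for x
    by (simp add: f(2)[OF that] g(2)[OF that] powr_add prod.distrib)
  then show ?thesis
    unfolding monomial_fun_def using f(1) g(1)
    by (intro exI[of _ "c * d"] conjI exI[of _ "\<lambda>v. a v + b v"]) auto
qed

lemma monomial_fun_inverse:
  assumes "monomial_fun V f"
  shows "monomial_fun V (\<lambda>x. inverse (f x))"
proof -
  obtain c a where f: "c > 0" "\<And>x. x \<in> pos_orthant V \<Longrightarrow> f x = c * (\<Prod>v\<in>V. x v powr a v)"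
    using assms by (auto simp: monomial_fun_def)
  have "inverse (f x) = inverse c * (\<Prod>v\<in>V. x v powr (- a v))" if "x \<in> pos_orthant V" for x
    by (simp add: f(2)[OF that] powr_minus prod_inversef[symmetric])
  then show ?thesis
    unfolding monomial_fun_def using f(1)
    by (intro exI[of _ "inverse c"] conjI exI[of _ "\<lambda>v. - a v"]) auto
qed

lemma monomial_fun_prod:
  assumes "\<And>i. i \<in> I \<Longrightarrow> monomial_fun V (f i)"
  shows "monomial_fun V (\<lambda>x. \<Prod>i\<in>I. f i x)"
  using assms
  by (induction I rule: infinite_finite_induct) (simp_all add: monomial_fun_const monomial_fun_mult)

lemma posynomial_fun_monomial: "monomial_fun V f \<Longrightarrow> posynomial_fun V f"
  unfolding posynomial_fun_def by (rule exI[of _ "[f]"]) auto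

lemma posynomial_fun_zero: "posynomial_fun V (\<lambda>x. 0)"
  unfolding posynomial_fun_def by (rule exI[of _ "[]"]) auto

lemma posynomial_fun_const:
  assumes "c \<ge> 0"
  shows "posynomial_fun V (\<lambda>x. c)"
proof (cases "c = 0")
  case True
  then show ?thesis by (simp add: posynomial_fun_zero)
next
  case False
  with assms have "c > 0" by simp
  then show ?thesis by (intro posynomial_fun_monomial monomial_fun_const)
qed

lemma posynomial_fun_add:
  assumes "posynomial_fun V f" "posynomial_fun V g"
  shows "posynomial_fun V (\<lambda>x. f x + g x)"
proof -
  obtain ms where ms: "\<forall>m\<in>set ms. monomial_fun V m" "\<forall>x\<in>pos_orthant V. f x = (\<Sum>m\<leftarrow>ms. m x)"
    using assms(1) unfolding posynomial_fun_def by blast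
  obtain ns where ns: "\<forall>m\<in>set ns. monomial_fun V m" "\<forall>x\<in>pos_orthant V. g x = (\<Sum>m\<leftarrow>ns. m x)"
    using assms(2) unfolding posynomial_fun_def by blast
  show ?thesis
    unfolding posynomial_fun_def using ms ns by (intro exI[of _ "ms @ ns"]) auto
qed

lemma posynomial_fun_sum:
  assumes "\<And>i. i \<in> I \<Longrightarrow> posynomial_fun V (f i)"
  shows "posynomial_fun V (\<lambda>x. \<Sum>i\<in>I. f i x)"
  using assms
  by (induction I rule: infinite_finite_induct) (simp_all add: posynomial_fun_zero posynomial_fun_add)

lemma posynomial_fun_mult_monomial:
  assumes "posynomial_fun V f" "monomial_fun V g"
  shows "posynomial_fun V (\<lambda>x. f x * g x)"
proof -
  obtain ms where ms: "\<forall>m\<in>set ms. monomial_fun V m" "\<forall>x\<in>pos_orthant V. f x = (\<Sum>m\<leftarrow>ms. m x)"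
    using assms(1) unfolding posynomial_fun_def by blast
  show ?thesis
    unfolding posynomial_fun_def using ms assms(2)
    by (intro exI[of _ "map (\<lambda>m x. m x * g x) ms"])
       (auto simp: sum_list_mult_const o_def intro: monomial_fun_mult)
qed

lemma lookup_scaleR:
  "Poly_Mapping.lookup (r *\<^sub>R t) v = r * Poly_Mapping.lookup t v"
proof -
  have "finite {v. r * Poly_Mapping.lookup t v \<noteq> 0}"
    by (rule finite_subset[of _ "Poly_Mapping.keys t"]) (auto simp: in_keys_iff)
  then show ?thesis
    by (simp add: scaleR_poly_mapping_def)
qed

lemma convex_log_space: "convex (log_space V)"
proof -
  have iff: "t \<in> log_space V \<longleftrightarrow> (\<forall>v. v \<notin> V \<longrightarrow> Poly_Mapping.lookup t v = 0)" for t
    by (auto simp: log_space_def in_keys_iff)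
  show ?thesis
    by (rule convexI) (simp add: iff lookup_add lookup_scaleR)
qed

lemma convex_on_monomial:
  assumes "monomial_fun V f"
  shows "convex_on (log_space V) (\<lambda>t. f (exp_point V t))"
proof -
  obtain c a where f: "c > 0" "\<And>x. x \<in> pos_orthant V \<Longrightarrow> f x = c * (\<Prod>v\<in>V. x v powr a v)"
    using assms by (auto simp: monomial_fun_def)
  define A where "A t = (\<Sum>v\<in>V. a v * Poly_Mapping.lookup t v)" for t :: "'a \<Rightarrow>\<^sub>0 real"
  have A: "A (r *\<^sub>R s + q *\<^sub>R t) = r * A s + q * A t" for r q s t
    by (simp add: A_def lookup_add lookup_scaleR algebra_simps sum.distrib sum_distrib_left)
  have "f (exp_point V t) = c * exp (A t)" for t
  proof (cases "finite V")
    case True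
    have "(\<Prod>v\<in>V. exp_point V t v powr a v) = (\<Prod>v\<in>V. exp (a v * Poly_Mapping.lookup t v))"
      by (rule prod.cong) (auto simp: exp_point_def powr_def)
    then show ?thesis
      by (simp add: f(2) exp_point_in_pos_orthant A_def exp_sum True)
  next
    \<comment> \<open>Over an infinite \<open>V\<close> the product is \<open>1\<close> and the sum \<open>A t\<close> is \<open>0\<close>.\<close>
    case False
    then show ?thesis
      by (simp add: f(2) exp_point_in_pos_orthant A_def)
  qed
  moreover have "convex_on (log_space V) (\<lambda>t. exp (A t))"
    using exp_convex convex_log_space[of V] by (auto simp: convex_on_def A)
  ultimately show ?thesis
    using f(1) by (simp add: convex_on_cmul)
qed

lemma convex_on_posynomial:
  assumes "posynomial_fun V f"
  shows "convex_on (log_space V) (\<lambda>t. f (exp_point V t))"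
proof -
  obtain ms where ms: "\<forall>m\<in>set ms. monomial_fun V m" "\<forall>x\<in>pos_orthant V. f x = (\<Sum>m\<leftarrow>ms. m x)"
    using assms unfolding posynomial_fun_def by blast
  have "convex_on (log_space V) (\<lambda>t. \<Sum>m\<leftarrow>ms. m (exp_point V t))"
    using ms(1)
  proof (induction ms)
    case Nil
    then show ?case using convex_log_space by (simp add: convex_on_def)
  next
    case (Cons m ms)
    then show ?case by (simp add: convex_on_add convex_on_monomial)
  qed
  then show ?thesis
    using ms(2) by (simp add: exp_point_in_pos_orthant)
qed

text \<open>The set is the sublevel set at \<open>1\<close> of the convex function given by the posynomial \<open>f / g\<close>; the
  sets where \<open>f \<le> g\<close> for two posynomials need not be convex.\<close>

lemma convex_log_le:
  assumes "posynomial_fun V f" "monomial_fun V g"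
  shows "convex {t \<in> log_space V. f (exp_point V t) \<le> g (exp_point V t)}"
proof -
  define h where "h x = f x * inverse (g x)" for x
  have "posynomial_fun V h"
    unfolding h_def using assms by (intro posynomial_fun_mult_monomial monomial_fun_inverse)
  then have h: "convex_on (log_space V) (\<lambda>t. h (exp_point V t))"
    by (rule convex_on_posynomial)
  have "f (exp_point V t) \<le> g (exp_point V t) \<longleftrightarrow> h (exp_point V t) \<le> 1" for t
    using monomial_fun_pos[OF assms(2) exp_point_in_pos_orthant, of t]
    by (simp add: h_def field_simps)
  moreover have "convex {t \<in> log_space V. h (exp_point V t) \<le> 1}"
  proof (rule convexI)
    fix s t and u v :: real
    assume s: "s \<in> {t \<in> log_space V. h (exp_point V t) \<le> 1}"
      and t: "t \<in> {t \<in> log_space V. h (exp_point V t) \<le> 1}"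
      and uv: "0 \<le> u" "0 \<le> v" "u + v = 1"
    have "h (exp_point V (u *\<^sub>R s + v *\<^sub>R t)) \<le> u * h (exp_point V s) + v * h (exp_point V t)"
      using h s t uv by (simp add: convex_on_def)
    also have "\<dots> \<le> u * 1 + v * 1"
      using s t uv by (intro add_mono mult_left_mono) auto
    finally show "u *\<^sub>R s + v *\<^sub>R t \<in> {t \<in> log_space V. h (exp_point V t) \<le> 1}"
      using s t uv convexD[OF convex_log_space] by auto
  qed
  ultimately show ?thesis by simp
qed

text \<open>An equation between monomials is the conjunction of two inequalities, each of which has a
  posynomial on its left and a monomial on its right.\<close>

lemma convex_log_cstr:
  assumes "gp_cstr V c"
  shows "convex {t \<in> log_space V. satisfies (exp_point V t) c}"
proof (cases c)
  case (Le f g)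
  then show ?thesis using assms convex_log_le by auto
next
  case (Eq f g)
  have "{t \<in> log_space V. satisfies (exp_point V t) c}
      = {t \<in> log_space V. f (exp_point V t) \<le> g (exp_point V t)}
        \<inter> {t \<in> log_space V. g (exp_point V t) \<le> f (exp_point V t)}"
    using Eq by auto
  then show ?thesis
    using assms Eq by (auto intro!: convex_Int convex_log_le posynomial_fun_monomial)
qed

lemma geometric_program_log_convex:
  assumes "geometric_program P"
  shows "convex_on (log_space (vars P)) (log_objective P)" "convex (log_feasible P)"
proof -
  show "convex_on (log_space (vars P)) (log_objective P)"
    using assms convex_on_posynomial[of "vars P" "objective P"]
    by (simp add: geometric_program_def log_objective_def[abs_def])
  have "log_feasible P
      = log_space (vars P) \<inter> (\<Inter>c\<in>cstrs P. {t \<in> log_space (vars P). satisfies (exp_point (vars P) t) c})"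
    by (auto simp: log_feasible_def feasible_def exp_point_in_pos_orthant)
  then show "convex (log_feasible P)"
    using assms
    by (auto simp: geometric_program_def intro!: convex_Int convex_INT convex_log_space convex_log_cstr)
qed

lemma finite_scale_vars: "finite (scale_vars N)"
  by (simp add: scale_vars_def)

lemma scale_vars_iff: "(l, i) \<in> scale_vars N \<longleftrightarrow> l \<in> {1..depth N - 1} \<and> i \<in> {1..width N l}"
  by (simp add: scale_vars_def)

lemma last_coeff_nonneg: "last_coeff N i \<ge> 0"
  by (simp add: last_coeff_def sum_nonneg)

text \<open>The powers that occur are powers of single variables. The bound \<open>2 \<le> depth N\<close> ensures
  that layers \<open>1\<close> and \<open>depth N - 1\<close> are among those carrying variables. A permuted index only
  selects coefficients and exponents, never a variable.\<close>

lemma posynomial_reg_objective: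
  assumes "depth N \<ge> 2" "mu N \<ge> 0"
  shows "posynomial_fun (scale_vars N) (reg_objective N)"
proof -
  let ?V = "scale_vars N"
  have var: "monomial_fun ?V (\<lambda>x. x (l, i) powr e)"
    if "l \<in> {1..depth N - 1}" "i \<in> {1..width N l}" for l i e
    using that by (intro monomial_fun_powr finite_scale_vars) (simp add: scale_vars_iff)
  have first: "posynomial_fun ?V (\<lambda>x. reg_first N (\<lambda>i. x (1, i)))"
    unfolding reg_first_def using assms
    by (intro posynomial_fun_sum posynomial_fun_mult_monomial posynomial_fun_const var) auto
  have mid: "posynomial_fun ?V (\<lambda>x. reg_mid N l (\<lambda>i. x (l - 1, i)) (perm N l) (\<lambda>i. x (l, i)))"
    if "l \<in> {2..depth N - 1}" for l
    unfolding reg_mid_def Let_def using assms that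
    by (intro posynomial_fun_sum posynomial_fun_mult_monomial posynomial_fun_add
        posynomial_fun_const var) auto
  have last: "posynomial_fun ?V (\<lambda>x. reg_last N (\<lambda>i. x (depth N - 1, i)))"
    unfolding reg_last_def using assms
    by (intro posynomial_fun_sum posynomial_fun_mult_monomial posynomial_fun_add
        posynomial_fun_const var) (auto simp: last_coeff_nonneg sum_nonneg)
  show ?thesis
    unfolding reg_objective_def[abs_def] reg_total_def
    by (intro posynomial_fun_add posynomial_fun_sum first mid last)
qed

lemma gp_cstr_unit_product:
  assumes "c \<in> unit_product_cstrs N"
  shows "gp_cstr (scale_vars N) c"
  using assms
  by (auto simp: unit_product_cstrs_def scale_vars_iff finite_scale_vars
      intro!: monomial_fun_prod monomial_fun_var monomial_fun_const)

lemma gp_cstr_box: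
  assumes "c \<in> box_cstrs N dmin dmax" "0 < dmin" "dmin \<le> dmax"
  shows "gp_cstr (scale_vars N) c"
  using assms
  by (auto simp: box_cstrs_def finite_scale_vars
      intro!: posynomial_fun_monomial monomial_fun_var monomial_fun_const)

lemma geometric_program_reg:
  assumes "depth N \<ge> 2" "mu N \<ge> 0" "0 < dmin" "dmin \<le> dmax"
  shows "geometric_program (reg_program N normalized boxed dmin dmax)"
proof -
  have "finite (unit_product_cstrs N)" "finite (box_cstrs N dmin dmax)"
    by (simp_all add: unit_product_cstrs_def box_cstrs_def finite_scale_vars)
  then show ?thesis
    using assms gp_cstr_unit_product gp_cstr_box
    by (auto simp: geometric_program_def reg_program_def finite_scale_vars posynomial_reg_objective)
qed

theorem mainTheorem2:
  fixes N :: net and normalized boxed :: bool and dmin dmax :: real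
  assumes "depth N \<ge> 2"
    and "\<And>l j. l \<in> {1..depth N} \<Longrightarrow> j \<in> {1..width N l} \<Longrightarrow> mult N l j \<ge> 1"
    and "\<And>l j k. l \<in> {1..depth N - 1} \<Longrightarrow> j \<in> {1..width N l} \<Longrightarrow> k \<in> {1..mult N l j}
           \<Longrightarrow> deg N l j k \<ge> 1"
    and "\<And>l. l \<in> {1..depth N - 1} \<Longrightarrow> expo N l > 0"
    and "mu N \<ge> 0"
    and "\<And>l. l \<in> {2..depth N - 1} \<Longrightarrow> perm N l permutes {1..width N l}"
    and "0 < dmin" and "dmin \<le> dmax"
  shows "posynomial_fun (scale_vars N) (reg_objective N)
    \<and> geometric_program (reg_program N normalized boxed dmin dmax)
    \<and> convex_on (log_space (scale_vars N)) (log_objective (reg_program N normalized boxed dmin dmax))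
    \<and> convex (log_feasible (reg_program N normalized boxed dmin dmax))"
proof -
  let ?P = "reg_program N normalized boxed dmin dmax"
  have gp: "geometric_program ?P"
    using assms by (intro geometric_program_reg)
  moreover have "vars ?P = scale_vars N"
    by (simp add: reg_program_def)
  ultimately show ?thesis
    using geometric_program_log_convex[OF gp] posynomial_reg_objective assms(1,5) by simp
qed

end
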